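(* Let $X$ be a set and let $f$ be a complementary choice function on $X$. Then there exist a set $Y$, a map $\varphi:Y\to X$, and a completely complementary choice function $g$ on $Y$ such that $f=\varphi_*(g)$, i.e. $f(A)=\varphi\big(g(\varphi^{-1}(A))\big)$ for every $A\subseteq X$.
   Context: A choice function (CF) on a set $X$ is a map $f:2^X\to 2^X$ with $f(A)\subseteq A$ for all $A\subseteq X$. A CF $f$ is consistent if $f(A)\subseteq B\subseteq A$ implies $f(B)=f(A)$; monotonic if $A\subseteq B$ implies $f(A)\subseteq f(B)$; complementary if it is consistent and monotonic. A consistent CF $g$ on $Y$ is completely complementary if $g(\bigcap_{i\in I}A_i)=\bigcap_{i\in I}g(A_i)$ for every family $(A_i)_{i\in I}$ of subsets of $Y$. For a map $\varphi:Y\to X$ and a CF $g$ on $Y$, the direct image $\varphi_*(g)$ is the CF on $X$ given by $A\mapsto \varphi(g(\varphi^{-1}(A)))$. *)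

theory Defs
  imports Main "HOL-Library.FuncSet"
begin

text \<open>
  A choice function on a set \<open>X\<close> is represented by a total function on \<open>'a set\<close> of which only
  the values on subsets of \<open>X\<close> matter.
\<close>

definition choice_function :: "'a set \<Rightarrow> ('a set \<Rightarrow> 'a set) \<Rightarrow> bool" where
  "choice_function X f \<longleftrightarrow> (\<forall>A. A \<subseteq> X \<longrightarrow> f A \<subseteq> A)"

definition consistent :: "'a set \<Rightarrow> ('a set \<Rightarrow> 'a set) \<Rightarrow> bool" where
  "consistent X f \<longleftrightarrow> (\<forall>A B. A \<subseteq> X \<longrightarrow> f A \<subseteq> B \<longrightarrow> B \<subseteq> A \<longrightarrow> f B = f A)"

definition monotonic :: "'a set \<Rightarrow> ('a set \<Rightarrow> 'a set) \<Rightarrow> bool" where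
  "monotonic X f \<longleftrightarrow> (\<forall>A B. A \<subseteq> B \<longrightarrow> B \<subseteq> X \<longrightarrow> f A \<subseteq> f B)"

definition complementary :: "'a set \<Rightarrow> ('a set \<Rightarrow> 'a set) \<Rightarrow> bool" where
  "complementary X f \<longleftrightarrow> choice_function X f \<and> consistent X f \<and> monotonic X f"

text \<open>
  A family of subsets of \<open>Y\<close> is given by the set of its members, since repetitions do not affect
  either intersection.  Intersections are taken inside \<open>Y\<close>: the empty family has intersection
  \<open>Y\<close>, whereas \<open>\<Inter>{}\<close> is \<open>UNIV\<close>.  For a nonempty family of subsets of \<open>Y\<close>, and a choice function
  \<open>g\<close> on \<open>Y\<close>, the extra \<open>Y \<inter>\<close> is redundant on both sides.
\<close>

definition completely_complementary :: "'a set \<Rightarrow> ('a set \<Rightarrow> 'a set) \<Rightarrow> bool" where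
  "completely_complementary Y g \<longleftrightarrow>
     choice_function Y g \<and> consistent Y g \<and>
     (\<forall>\<A>. \<A> \<subseteq> Pow Y \<longrightarrow> g (Y \<inter> \<Inter>\<A>) = Y \<inter> (\<Inter>A\<in>\<A>. g A))"

text \<open>The preimage of \<open>A\<close> under \<open>\<phi> : Y \<rightarrow> X\<close> is \<open>\<phi> -` A \<inter> Y\<close>, as \<open>\<phi>\<close> is total on its type.\<close>

definition direct_image :: "'b set \<Rightarrow> ('b \<Rightarrow> 'a) \<Rightarrow> ('b set \<Rightarrow> 'b set) \<Rightarrow> 'a set \<Rightarrow> 'a set" where
  "direct_image Y \<phi> g A = \<phi> ` g (\<phi> -` A \<inter> Y)"

end

theory Submission
  imports Defs
begin

text \<open>
  A complementary choice function is an interior operator: \<open>f A\<close> is the union of the sets \<open>S \<subseteq> A\<close>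
  fixed by \<open>f\<close>.  Taking for \<open>Y\<close> the disjoint union of all fixed sets, for \<open>\<phi>\<close> the projection to
  \<open>X\<close>, and letting \<open>g\<close> keep from \<open>B \<subseteq> Y\<close> exactly the copies that lie entirely in \<open>B\<close>, one obtains
  \<open>f\<close> as the direct image of \<open>g\<close>; and \<open>g\<close> commutes with intersections because the copies are
  disjoint.
\<close>

definition total_space :: "'a set set \<Rightarrow> ('a \<times> 'a set) set" where
  "total_space \<S> = {(x, S). S \<in> \<S> \<and> x \<in> S}"

definition full_copies :: "('a \<times> 'a set) set \<Rightarrow> ('a \<times> 'a set) set" where
  "full_copies B = {(x, S). x \<in> S \<and> S \<times> {S} \<subseteq> B}"

text \<open>Whether \<open>(x, S)\<close> is kept depends only on
  \<open>S \<times> {S} \<subseteq> B\<close>, a condition that holds for an intersection iff it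
  holds for each member.\<close>

lemma completely_complementary_full_copies:
  "completely_complementary (total_space \<S>) full_copies"
proof -
  have "full_copies B = full_copies A" if "full_copies A \<subseteq> B" "B \<subseteq> A" for A B :: "('a \<times> 'a set) set"
  proof (rule equalityI)
    show "full_copies B \<subseteq> full_copies A"
      using that(2) by (auto simp: full_copies_def)
    \<comment> \<open>Copies are kept whole or dropped whole, so a copy full in \<open>A\<close>
      lies entirely in \<open>full_copies A\<close>, hence in \<open>B\<close>.\<close>
    have "S \<times> {S} \<subseteq> full_copies A" if "(x, S) \<in> full_copies A" for x S
      using that by (auto simp: full_copies_def)
    then show "full_copies A \<subseteq> full_copies B"
      using that(1) by (force simp: full_copies_def)
  qed
  \<comment> \<open>For the empty family this says that every copy is full in the total
    space.\<close>
  moreover have "full_copies (total_space \<S> \<inter> \<Inter>\<A>) = total_space \<S> \<inter> (\<Inter>A\<in>\<A>. full_copies A)" for \<A>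
    by (auto simp: full_copies_def total_space_def)
  moreover have "full_copies B \<subseteq> B" for B :: "('a \<times> 'a set) set"
    by (auto simp: full_copies_def)
  ultimately show ?thesis
    by (simp add: completely_complementary_def choice_function_def consistent_def)
qed

text \<open>The preimage of \<open>A\<close> contains the whole copy of a member \<open>S\<close>
  iff \<open>S \<subseteq> A\<close>; \<open>fst\<close> projects the copies of these
  \<open>S\<close> onto their union.\<close>

lemma direct_image_full_copies:
  fixes \<S> :: "'a set set"
  shows "direct_image (total_space \<S>) fst full_copies A = \<Union>{S \<in> \<S>. S \<subseteq> A}"
proof -
  have "full_copies (fst -` A \<inter> total_space \<S>) = total_space {S \<in> \<S>. S \<subseteq> A}"
  proof (intro set_eqI)
    fix p :: "'a \<times> 'a set"
    obtain x S where p: "p = (x, S)"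
      by (cases p)
    \<comment> \<open>For empty \<open>S\<close> the left side holds vacuously, even if
      \<open>S\<close> is not in \<open>\<S>\<close>; hence the condition
      \<open>x \<in> S\<close>.\<close>
    have "S \<times> {S} \<subseteq> fst -` A \<inter> total_space \<S> \<longleftrightarrow> S \<subseteq> A \<and> S \<in> \<S>" if "x \<in> S"
      using that by (auto simp: total_space_def subset_iff)
    then show "p \<in> full_copies (fst -` A \<inter> total_space \<S>) \<longleftrightarrow> p \<in> total_space {S \<in> \<S>. S \<subseteq> A}"
      by (auto simp: p full_copies_def total_space_def[of "{S \<in> \<S>. S \<subseteq> A}"])
  qed
  moreover have "fst ` total_space \<T> = \<Union>\<T>" for \<T> :: "'a set set"
    by (simp add: total_space_def set_eq_iff image_iff Bex_def conj_commute)
  ultimately show ?thesis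
    by (simp add: direct_image_def)
qed

text \<open>By consistency \<open>f A\<close> is itself a fixed set inside \<open>A\<close>; by
  monotonicity it contains every other one.\<close>

lemma complementary_eq_Union_fixed:
  assumes "complementary X f" and "A \<subseteq> X"
  shows "f A = \<Union>{S \<in> {S. S \<subseteq> X \<and> f S = S}. S \<subseteq> A}"
proof
  have "f A \<subseteq> A"
    using assms by (simp add: complementary_def choice_function_def)
  moreover from this have "f (f A) = f A"
    using assms unfolding complementary_def consistent_def by blast
  ultimately show "f A \<subseteq> \<Union>{S \<in> {S. S \<subseteq> X \<and> f S = S}. S \<subseteq> A}"
    using assms(2) by blast
  have "S \<subseteq> f A" if "f S = S" "S \<subseteq> A" for S
    using assms that unfolding complementary_def monotonic_def by metis
  then show "\<Union>{S \<in> {S. S \<subseteq> X \<and> f S = S}. S \<subseteq> A} \<subseteq> f A"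
    by blast
qed

theorem theorem2:
  fixes X :: "'a set" and f :: "'a set \<Rightarrow> 'a set"
  assumes "complementary X f"
  shows "\<exists>(Y :: ('a \<times> 'a set) set) (\<phi> :: 'a \<times> 'a set \<Rightarrow> 'a)
            (g :: ('a \<times> 'a set) set \<Rightarrow> ('a \<times> 'a set) set).
           \<phi> \<in> Y \<rightarrow> X \<and> completely_complementary Y g \<and>
           (\<forall>A. A \<subseteq> X \<longrightarrow> f A = direct_image Y \<phi> g A)"
proof (intro exI conjI allI impI)
  let ?\<S> = "{S. S \<subseteq> X \<and> f S = S}"
  show "fst \<in> total_space ?\<S> \<rightarrow> X"
    by (auto simp: total_space_def)
  show "completely_complementary (total_space ?\<S>) full_copies"
    by (rule completely_complementary_full_copies)
  show "f A = direct_image (total_space ?\<S>) fst full_copies A" if "A \<subseteq> X" for A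
    unfolding direct_image_full_copies by (rule complementary_eq_Union_fixed[OF assms that])
qed

end
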